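(* Fix $2\leq p \leq 4$ and let $\delta_1,\delta_2>0$ satisfy $1-2/p \leq \delta_1 \leq 1$ and $2-4/p \leq \delta_2 \leq 1$. Then $$\mathscr{E}_p(\delta_1, \delta_2)=\sum_{n=0}^{\infty} \int_{n}^{n+2/p} \frac{\sin^2\left(\frac{p}{2}\pi(x-n)\right)}{\pi^2 x^2}\,dx.$$ For $2 \leq p <4$ the supremum defining $\mathscr{E}_p(\delta_1,\delta_2)$ is attained at $\tau \in T(\delta_1,\delta_2)$ if and only if $\tau_n$ is in the interval $[n-1+2/p,\,n]$ for all $n \geq 1$. If $p=4$ the supremum is attained for all sequences $\tau$ in $T(\delta_1, \delta_2)$.
   Context: For $\delta_1,\delta_2>0$ let $T(\delta_1,\delta_2)$ be the set of strictly increasing real sequences $\tau=(\tau_n)_{n\ge 0}$ with $\tau_0=0$, $\tau_1\ge\delta_1$ and $\tau_{n+1}-\tau_n\ge\delta_2$ for all $n\ge1$. For $0<p<\infty$ and such a sequence $\tau$ define $$K_p(\tau;x)=\sum_{n=0}^\infty \chi_{(\tau_n,\tau_{n+1})}(x)\,\frac{\sin\left(\frac p2\pi(x-n)\right)}{\pi x},\qquad E_p(\tau)=\int_0^\infty\left(\max\left(0,K_p(\tau;x)\right)\right)^2dx,$$ where $\chi_{(a,b)}$ is the characteristic function of $(a,b)$, and $$\mathscr{E}_p(\delta_1,\delta_2)=\sup_{\tau\in T(\delta_1,\delta_2)}E_p(\tau).$$ *)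

theory Defs
  imports "HOL-Analysis.Analysis"
begin

definition T_seq :: "real \<Rightarrow> real \<Rightarrow> (nat \<Rightarrow> real) set" where
  "T_seq \<delta>1 \<delta>2 =
    {\<tau>. strict_mono \<tau> \<and> \<tau> 0 = 0 \<and> \<tau> 1 \<ge> \<delta>1 \<and> (\<forall>n\<ge>1. \<tau> (n + 1) - \<tau> n \<ge> \<delta>2)}"

text \<open>The intervals are pairwise disjoint for increasing \<open>\<tau>\<close>, so for each \<open>x\<close> at most one
  summand is nonzero and the series converges.\<close>
definition K_fun :: "real \<Rightarrow> (nat \<Rightarrow> real) \<Rightarrow> real \<Rightarrow> real" where
  "K_fun p \<tau> x =
    (\<Sum>n. indicator {\<tau> n<..<\<tau> (n + 1)} x * (sin (p / 2 * pi * (x - real n)) / (pi * x)))"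

text \<open>The integrand is nonnegative, so the integral and the supremum are taken in
  \<open>[0, \<infinity>]\<close>, where they always exist.\<close>
definition E_val :: "real \<Rightarrow> (nat \<Rightarrow> real) \<Rightarrow> ennreal" where
  "E_val p \<tau> = (\<integral>\<^sup>+x\<in>{0..}. ennreal ((max 0 (K_fun p \<tau> x))\<^sup>2) \<partial>lborel)"

definition E_sup :: "real \<Rightarrow> real \<Rightarrow> real \<Rightarrow> ennreal" where
  "E_sup p \<delta>1 \<delta>2 = (SUP \<tau>\<in>T_seq \<delta>1 \<delta>2. E_val p \<tau>)"

end

theory Submission
  imports Defs
begin

text \<open>
  Put \<open>L = 2 / p \<in> [1 / 2, 1]\<close> and let \<open>bump p\<close> be the square of the positive part of
  \<open>sin (p / 2 * pi * y)\<close>, which has period \<open>2 * L\<close>, is positive on \<open>(0, L)\<close> and vanishes on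
  \<open>[- L, 0]\<close>. Up to the weight \<open>1 / (pi * x)\<^sup>2\<close>, the integrand of \<open>E_val p \<tau>\<close> is
  \<open>bump p (x - n)\<close> on \<open>(\<tau> n, \<tau> (n + 1))\<close>: one may switch from one translate of the bump to
  the next, and \<open>\<tau>\<close> records when. The claimed supremum is the value at \<open>\<tau> n = n\<close>, the ideal
  sequence.

  The weight is decreasing, and by \<open>inverse_square_integral_layers\<close> the value \<open>E_val p \<tau>\<close> is
  a positive average over \<open>t\<close> of the unweighted masses collected on \<open>[0, t]\<close>. So it suffices
  to show that no admissible sequence has, at any time \<open>t\<close>, collected more than the ideal
  one (\<open>collected_le_ideal\<close>); and a sequence attains the finite supremum only if it collects
  the same mass for almost every \<open>t\<close>.

  Let \<open>H\<close> be the primitive of the bump with \<open>H 0 = 0\<close>, and \<open>B\<close> the mass of one bump. After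
  \<open>N\<close> switches the mass collected up to \<open>t\<close> is \<open>H (t - N)\<close> plus a boundary term
  \<open>H \<psi> - H (\<psi> - 1)\<close> for each switch, \<open>\<psi>\<close> being the phase just before it. A boundary term is
  at most \<open>B\<close>, since a window of length \<open>1 \<le> 2 * L\<close> holds at most one bump. This settles the
  case of too few switches. With too many switches, the lower bounds on the gaps are needed:
  by \<open>H (\<psi> - 1) + B = H (\<psi> + 2 * L - 1)\<close> a switch at phase \<open>\<psi>\<close> loses
  \<open>H (\<psi> + 2 * L - 1) - H \<psi>\<close>, and the gap condition forces these windows to overlap or to
  touch as the phase decreases. So the losses telescope (\<open>switch_gain_le_early\<close>) and
  compensate the surplus.

  For \<open>L > 1 / 2\<close>, the first switch outside \<open>[n - 1 + L, n]\<close> makes the collected mass fall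
  strictly below the ideal one on some open interval (\<open>in_range_if_collected_eq_ideal\<close>),
  whereas switches inside these ranges happen where both translates of the bump vanish. For
  \<open>L = 1 / 2\<close> all translates coincide, so switching has no effect.
\<close>

section \<open>Integrals against a decreasing weight\<close>

lemma inverse_square_layers:
  fixes x :: real
  assumes "0 < x"
  shows "(\<integral>\<^sup>+t\<in>{x..}. ennreal (2 / (pi\<^sup>2 * t ^ 3)) \<partial>lborel) = ennreal (1 / (pi * x)\<^sup>2)"
proof -
  define F where "F t = - (1 / (pi\<^sup>2 * t\<^sup>2))" for t :: real
  have "(\<integral>\<^sup>+t. ennreal (2 / (pi\<^sup>2 * t ^ 3)) * indicator {x..} t \<partial>lborel) = ennreal (0 - F x)"
  proof (rule nn_integral_FTC_atLeast)
    show "DERIV F t :> 2 / (pi\<^sup>2 * t ^ 3)" if "x \<le> t" for t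
      unfolding F_def using that assms
      by (auto intro!: derivative_eq_intros simp: divide_simps power2_eq_square power3_eq_cube)
    show "(F \<longlongrightarrow> 0) at_top"
      unfolding F_def by real_asymp
    show "0 \<le> 2 / (pi\<^sup>2 * t ^ 3)" if "x \<le> t" for t
      using that assms by simp
  qed measurable
  then show ?thesis by (simp add: F_def power_mult_distrib)
qed

text \<open>
  The layer cake formula for the decreasing weight \<open>1 / (pi * x)\<^sup>2\<close>: writing the weight as
  an integral over \<open>[x, \<infinity>)\<close> and exchanging the integrals expresses the weighted integral as
  a positive average of the cumulative integrals, so these suffice for comparing two
  integrands.
\<close>

lemma inverse_square_integral_layers:
  fixes g :: "real \<Rightarrow> real"
  assumes [measurable]: "g \<in> borel_measurable borel" and nonneg: "\<And>x. 0 \<le> g x"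
  shows "(\<integral>\<^sup>+x\<in>{0..}. ennreal (g x / (pi * x)\<^sup>2) \<partial>lborel) =
    (\<integral>\<^sup>+t\<in>{0<..}. ennreal (2 / (pi\<^sup>2 * t ^ 3)) * (\<integral>\<^sup>+x\<in>{0..t}. ennreal (g x) \<partial>lborel) \<partial>lborel)"
proof -
  let ?k = "\<lambda>t. ennreal (2 / (pi\<^sup>2 * t ^ 3))"
  let ?f = "\<lambda>x t. ennreal (g x) * indicator {0<..} x * (?k t * indicator {x..} t)"
  have m[measurable]: "case_prod ?f \<in> borel_measurable (lborel \<Otimes>\<^sub>M lborel)"
  proof -
    have eq: "case_prod ?f = (\<lambda>z. ennreal (g (fst z)) * indicator {0<..} (fst z) *
        (?k (snd z) * indicator {z. fst z \<le> snd z} z))"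
      by (auto simp: fun_eq_iff split: split_indicator)
    have [measurable]: "{z::real \<times> real. fst z \<le> snd z} \<in> sets (lborel \<Otimes>\<^sub>M lborel)"
      unfolding lborel_prod sets_lborel by (intro borel_closed closed_Collect_le continuous_intros)
    show ?thesis unfolding eq by measurable
  qed
  have "(\<integral>\<^sup>+x\<in>{0..}. ennreal (g x / (pi * x)\<^sup>2) \<partial>lborel) = (\<integral>\<^sup>+x. (\<integral>\<^sup>+t. ?f x t \<partial>lborel) \<partial>lborel)"
  proof (intro nn_integral_cong_AE eventually_mono[OF AE_lborel_singleton[of 0]])
    fix x :: real
    assume "x \<noteq> 0"
    show "ennreal (g x / (pi * x)\<^sup>2) * indicator {0..} x = (\<integral>\<^sup>+t. ?f x t \<partial>lborel)"
    proof (cases "0 < x")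
      case True
      have "(\<integral>\<^sup>+t. ?f x t \<partial>lborel) = ennreal (g x) * (\<integral>\<^sup>+t\<in>{x..}. ?k t \<partial>lborel)"
        using True by (simp add: nn_integral_cmult)
      also have "\<dots> = ennreal (g x / (pi * x)\<^sup>2)"
        using inverse_square_layers[OF True] nonneg[of x]
        by (simp add: ennreal_mult[symmetric])
      finally show ?thesis using True by simp
    qed (use \<open>x \<noteq> 0\<close> in simp)
  qed
  also have "\<dots> = (\<integral>\<^sup>+t. (\<integral>\<^sup>+x. ?f x t \<partial>lborel) \<partial>lborel)"
    by (rule lborel_pair.Fubini'[OF m, symmetric])
  also have "\<dots> = (\<integral>\<^sup>+t\<in>{0<..}. ?k t * (\<integral>\<^sup>+x\<in>{0..t}. ennreal (g x) \<partial>lborel) \<partial>lborel)"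
  proof (rule nn_integral_cong)
    fix t :: real
    have "(\<integral>\<^sup>+x. ?f x t \<partial>lborel) = (\<integral>\<^sup>+x. ?k t * indicator {0<..} t * (ennreal (g x) * indicator {0..t} x) \<partial>lborel)"
      by (intro nn_integral_cong_AE eventually_mono[OF AE_lborel_singleton[of 0]])
        (auto split: split_indicator simp: mult_ac)
    also have "\<dots> = ?k t * indicator {0<..} t * (\<integral>\<^sup>+x\<in>{0..t}. ennreal (g x) \<partial>lborel)"
      by (rule nn_integral_cmult) measurable
    finally show "(\<integral>\<^sup>+x. ?f x t \<partial>lborel) = ?k t * (\<integral>\<^sup>+x\<in>{0..t}. ennreal (g x) \<partial>lborel) * indicator {0<..} t"
      by (simp add: mult_ac)
  qed
  finally show ?thesis .
qed

lemma inverse_square_integral_mono: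
  fixes f g :: "real \<Rightarrow> real"
  assumes "f \<in> borel_measurable borel" "\<And>x. 0 \<le> f x"
    and "g \<in> borel_measurable borel" "\<And>x. 0 \<le> g x"
    and "\<And>t. 0 < t \<Longrightarrow>
      (\<integral>\<^sup>+x\<in>{0..t}. ennreal (f x) \<partial>lborel) \<le> (\<integral>\<^sup>+x\<in>{0..t}. ennreal (g x) \<partial>lborel)"
  shows "(\<integral>\<^sup>+x\<in>{0..}. ennreal (f x / (pi * x)\<^sup>2) \<partial>lborel) \<le>
    (\<integral>\<^sup>+x\<in>{0..}. ennreal (g x / (pi * x)\<^sup>2) \<partial>lborel)"
  unfolding inverse_square_integral_layers[OF assms(1,2)] inverse_square_integral_layers[OF assms(3,4)]
  by (intro nn_integral_mono) (auto split: split_indicator intro!: mult_left_mono assms(5))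

lemma borel_measurable_cumulative:
  fixes f :: "real \<Rightarrow> real"
  assumes [measurable]: "f \<in> borel_measurable borel"
  shows "(\<lambda>t. \<integral>\<^sup>+x\<in>{0..t}. ennreal (f x) \<partial>lborel) \<in> borel_measurable borel"
proof -
  have [measurable]: "{z::real \<times> real. snd z \<le> fst z} \<in> sets (borel \<Otimes>\<^sub>M lborel)"
    unfolding sets_pair_measure_cong[OF refl sets_lborel] borel_prod
    by (intro borel_closed closed_Collect_le continuous_intros)
  have "(\<lambda>z::real \<times> real. ennreal (f (snd z)) * (indicator {0..} (snd z) * indicator {z. snd z \<le> fst z} z))
      \<in> borel_measurable (borel \<Otimes>\<^sub>M lborel)"
    by measurable
  from lborel.borel_measurable_nn_integral_fst[OF this]
  show ?thesis
    by (rule measurable_cong[THEN iffD1, rotated])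
      (auto intro!: nn_integral_cong split: split_indicator)
qed

text \<open>
  Two nonnegative integrands with ordered, equal and finite integrals agree almost
  everywhere; the integrands here are the weighted cumulative integrals, whose weight is
  positive.
\<close>

lemma inverse_square_integral_eq_imp_AE:
  fixes f g :: "real \<Rightarrow> real"
  assumes f: "f \<in> borel_measurable borel" "\<And>x. 0 \<le> f x"
    and g: "g \<in> borel_measurable borel" "\<And>x. 0 \<le> g x"
    and le: "\<And>t. 0 < t \<Longrightarrow>
      (\<integral>\<^sup>+x\<in>{0..t}. ennreal (f x) \<partial>lborel) \<le> (\<integral>\<^sup>+x\<in>{0..t}. ennreal (g x) \<partial>lborel)"
    and eq: "(\<integral>\<^sup>+x\<in>{0..}. ennreal (f x / (pi * x)\<^sup>2) \<partial>lborel) =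
      (\<integral>\<^sup>+x\<in>{0..}. ennreal (g x / (pi * x)\<^sup>2) \<partial>lborel)"
    and finite: "(\<integral>\<^sup>+x\<in>{0..}. ennreal (f x / (pi * x)\<^sup>2) \<partial>lborel) < \<infinity>"
  shows "AE t in lborel. 0 < t \<longrightarrow>
    (\<integral>\<^sup>+x\<in>{0..t}. ennreal (f x) \<partial>lborel) = (\<integral>\<^sup>+x\<in>{0..t}. ennreal (g x) \<partial>lborel)"
proof -
  let ?k = "\<lambda>t::real. ennreal (2 / (pi\<^sup>2 * t ^ 3))"
  let ?F = "\<lambda>t. \<integral>\<^sup>+x\<in>{0..t}. ennreal (f x) \<partial>lborel" and ?G = "\<lambda>t. \<integral>\<^sup>+x\<in>{0..t}. ennreal (g x) \<partial>lborel"
  let ?u = "\<lambda>t. ?k t * ?F t * indicator {0<..} t" and ?v = "\<lambda>t. ?k t * ?G t * indicator {0<..} t"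
  note [measurable] = borel_measurable_cumulative[OF f(1)] borel_measurable_cumulative[OF g(1)]
  have uv: "?u t \<le> ?v t" for t
    by (auto split: split_indicator intro!: mult_left_mono le)
  have I: "(\<integral>\<^sup>+t. ?u t \<partial>lborel) = (\<integral>\<^sup>+t. ?v t \<partial>lborel)" "(\<integral>\<^sup>+t. ?u t \<partial>lborel) < \<infinity>"
    using eq finite
    unfolding inverse_square_integral_layers[OF f] inverse_square_integral_layers[OF g] by auto
  have [measurable]: "?u \<in> borel_measurable lborel" "?v \<in> borel_measurable lborel" by measurable
  have "(\<integral>\<^sup>+t. (?v t - ?u t) \<partial>lborel) = 0"
    using I uv by (subst nn_integral_diff) auto
  then have "AE t in lborel. ?v t - ?u t = 0"
    by (subst (asm) nn_integral_0_iff_AE) auto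
  moreover have "AE t in lborel. ?u t \<noteq> \<infinity>"
    using I by (intro nn_integral_PInf_AE) auto
  ultimately show ?thesis
  proof eventually_elim
    case (elim t)
    show ?case
    proof
      assume t: "0 < t"
      have "?v t \<le> ?u t" using elim by (simp add: diff_eq_0_iff_ennreal)
      then have "?k t * ?G t = ?k t * ?F t" using uv[of t] t by simp
      moreover have "?k t \<noteq> 0" using t by (simp add: ennreal_eq_0_iff not_le)
      ultimately show "?F t = ?G t" by (simp add: ennreal_mult_cancel_left)
    qed
  qed
qed

lemma AE_lborel_imp_ex_between:
  fixes a b :: real
  assumes "AE t in lborel. P t" "a < b"
  shows "\<exists>t. a < t \<and> t < b \<and> P t"
proof (rule ccontr)
  assume none: "\<not> ?thesis"
  have "AE t in lborel. t \<notin> {a<..<b}"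
    using assms(1) by eventually_elim (use none in auto)
  then have "{a<..<b} \<in> null_sets lborel" by (subst AE_iff_null_sets) auto
  then show False using assms(2) by (simp add: null_sets_def)
qed

section \<open>Comparing the collected mass with the ideal one\<close>

text \<open>
  The primitive of the periodic bump enters the combinatorial part only through the
  following properties, where \<open>L\<close> is the length of a bump, \<open>2 * L\<close> the period and \<open>B\<close> the
  mass of one bump.
\<close>

locale bump_primitive =
  fixes L B :: real and H :: "real \<Rightarrow> real"
  assumes L_ge: "1 / 2 \<le> L" and L_le: "L \<le> 1"
    and mono: "x \<le> y \<Longrightarrow> H x \<le> H y"
    and shift: "H (y + 2 * L) = H y + B"
    and rest: "- L \<le> y \<Longrightarrow> y \<le> 0 \<Longrightarrow> H y = 0"
    and strict: "0 \<le> x \<Longrightarrow> x < y \<Longrightarrow> y \<le> L \<Longrightarrow> H x < H y"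
begin

lemma plateau: "L \<le> y \<Longrightarrow> y \<le> 2 * L \<Longrightarrow> H y = B"
  using shift[of "y - 2 * L"] rest[of "y - 2 * L"] by simp

lemma unit_window: "H (y + 1) \<le> H y + B"
  using mono[of "y + 1" "y + 2 * L"] shift[of y] L_ge by simp

lemma double_window: "H y + B \<le> H (y + 2)"
  using mono[of "y + 2 * L" "y + 2"] shift[of y] L_le by simp

text \<open>
  The mass collected up to time \<open>t\<close> by the sequence \<open>\<tau> n = n\<close>: every unit interval
  contributes one full bump, at its beginning. The formula continues this function to
  negative \<open>t\<close>, so that a time \<open>t\<close> and its phase \<open>t - N\<close> give values that differ by \<open>N * B\<close>.
\<close>

definition ideal :: "real \<Rightarrow> real" where
  "ideal t = H (frac t) + of_int \<lfloor>t\<rfloor> * B"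

lemma ideal_add_nat: "ideal (t + real n) = ideal t + real n * B"
proof -
  have "\<lfloor>t + real n\<rfloor> = \<lfloor>t\<rfloor> + int n" by linarith
  then show ?thesis by (simp add: ideal_def frac_def algebra_simps)
qed

lemma ideal_unit_interval:
  assumes "0 \<le> y" "y \<le> 1"
  shows "ideal y = H y"
proof (cases "y = 1")
  case True
  then show ?thesis using plateau[of 1] rest[of 0] L_ge L_le by (simp add: ideal_def)
next
  case False
  then have "\<lfloor>y\<rfloor> = 0" using assms by linarith
  then show ?thesis by (simp add: ideal_def frac_def)
qed

text \<open>
  Never switching again is no better than switching at every integer, because a window of
  length \<open>1 \<le> 2 * L\<close> contains at most the mass of one bump.
\<close>

lemma primitive_le_ideal:
  assumes "0 \<le> y"
  shows "H y \<le> ideal y"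
proof -
  have "H (u + real n) \<le> ideal (u + real n)" if "0 \<le> u" "u \<le> 1" for u n
  proof (induction n)
    case 0
    then show ?case using ideal_unit_interval that by simp
  next
    case (Suc n)
    then show ?case
      using unit_window[of "u + real n"] ideal_add_nat[of "u + real n" 1]
      by (simp add: algebra_simps)
  qed
  from this[of "frac y" "nat \<lfloor>y\<rfloor>"] show ?thesis
    using assms frac_lt_1[of y] by (simp add: frac_def)
qed

text \<open>
  This is the comparison for a sequence that has switched too often, whose current phase \<open>y\<close>
  is therefore negative. On \<open>[- 1, 0]\<close> it is just \<open>H y \<le> 0\<close>. A shift of \<open>y\<close> by \<open>- 1\<close>
  replaces \<open>H (y + 1)\<close> by \<open>H (y - 1)\<close>; these are \<open>2 \<ge> 2 * L\<close> apart, so the left side drops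
  by at least \<open>B\<close>, and the right side by exactly \<open>B\<close>.
\<close>

lemma primitive_pair_le_ideal:
  assumes "y \<le> 0"
  shows "H y + H (y + 1) \<le> ideal y + B"
proof -
  have "H (u - real n) + H (u - real n + 1) \<le> ideal (u - real n) + B"
    if "- 1 \<le> u" "u \<le> 0" for u n
  proof (induction n)
    case 0
    have "H u \<le> 0" using mono[of u 0] rest[of 0] that L_ge by simp
    then show ?case
      using ideal_unit_interval[of "u + 1"] ideal_add_nat[of u 1] that by simp
  next
    case (Suc n)
    have "H (u - real n - 1) + B \<le> H (u - real n + 1)"
      using double_window[of "u - real n - 1"] by (simp add: algebra_simps)
    moreover have "ideal (u - real n) = ideal (u - real n - 1) + B"
      using ideal_add_nat[of "u - real n - 1" 1] by simp
    ultimately show ?case using Suc.IH by (simp add: algebra_simps)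
  qed
  from this[of "- frac (- y)" "nat \<lfloor>- y\<rfloor>"] show ?thesis
    using assms frac_lt_1[of "- y"] of_int_floor_le[of "- y"] by (simp add: frac_def)
qed

text \<open>
  Integrating the bump of index \<open>n\<close> over \<open>(\<tau> n, \<tau> (n + 1))\<close> and summing, the mass collected
  up to a time \<open>t\<close> in the \<open>N\<close>-th interval becomes \<open>H (t - N)\<close> plus the following boundary
  terms, one for each switch.
\<close>

definition switch_gain :: "(nat \<Rightarrow> real) \<Rightarrow> nat \<Rightarrow> real" where
  "switch_gain \<tau> N =
    (\<Sum>n<N. H (\<tau> (Suc n) - real n) - H (\<tau> (Suc n) - real (Suc n)))"

lemma switch_gain_le: "switch_gain \<tau> N \<le> real N * B"
proof (induction N)
  case (Suc N)
  then show ?case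
    using unit_window[of "\<tau> (Suc N) - real (Suc N)"]
    by (simp add: switch_gain_def algebra_simps)
qed (simp add: switch_gain_def)

text \<open>
  This is where the lower bounds on the gaps act. Relative to the bound \<open>N * B\<close>, the switch
  at phase \<open>\<psi> = \<tau> (n + 1) - n\<close> loses the mass of the window \<open>[\<psi>, \<psi> + 2 * L - 1]\<close>. The gap
  condition says that \<open>\<psi>\<close> decreases by at most the window length \<open>2 * L - 1\<close> from one switch
  to the next, and the first window reaches \<open>L\<close>. Hence the windows cover everything between
  the current phase and \<open>L\<close>: one cannot move ahead of the bumps without having paid for the
  bump passed over.
\<close>

lemma switch_gain_le_early:
  assumes first: "1 - L \<le> \<tau> 1"
    and spacing: "\<And>n. 1 \<le> n \<Longrightarrow> 2 - 2 * L \<le> \<tau> (Suc n) - \<tau> n"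
  shows "switch_gain \<tau> (Suc N) \<le> real N * B + H (\<tau> (Suc N) - real N)"
proof (induction N)
  case 0
  have "0 \<le> H (\<tau> 1 - 1)"
    using mono[of "- L" "\<tau> 1 - 1"] rest[of "- L"] first L_ge by simp
  then show ?case by (simp add: switch_gain_def)
next
  case (Suc N)
  have "H (\<tau> (Suc N) - real N) \<le> H (\<tau> (Suc (Suc N)) - real N - 2 + 2 * L)"
    using mono spacing[of "Suc N"] by simp
  then have "H (\<tau> (Suc N) - real N) \<le> H (\<tau> (Suc (Suc N)) - real N - 2) + B"
    by (simp add: shift)
  then show ?case
    using Suc.IH by (simp add: switch_gain_def algebra_simps)
qed

lemma collected_nonneg:
  assumes "strict_mono \<tau>" "\<tau> 0 = 0" "\<tau> N \<le> t"
  shows "0 \<le> H (t - real N) + switch_gain \<tau> N"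
proof -
  have "0 \<le> H (\<tau> N - real N) + switch_gain \<tau> N"
  proof (induction N)
    case 0
    then show ?case using assms(2) rest[of 0] L_ge by (simp add: switch_gain_def)
  next
    case (Suc N)
    have "H (\<tau> N - real N) \<le> H (\<tau> (Suc N) - real N)"
      using strict_mono_less_eq[OF assms(1), of N "Suc N"] by (intro mono) simp
    then show ?case using Suc.IH by (simp add: switch_gain_def)
  qed
  then show ?thesis using mono[of "\<tau> N - real N" "t - real N"] assms(3) by simp
qed

lemma switch_gain_in_range:
  assumes "\<And>n. 1 \<le> n \<Longrightarrow> n \<le> N \<Longrightarrow> real n - 1 + L \<le> \<tau> n \<and> \<tau> n \<le> real n"
  shows "switch_gain \<tau> N = real N * B"
proof -
  have "H (\<tau> (Suc n) - real n) - H (\<tau> (Suc n) - real (Suc n)) = B" if "n < N" for n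
    using assms[of "Suc n"] that plateau[of "\<tau> (Suc n) - real n"]
      rest[of "\<tau> (Suc n) - real (Suc n)"] L_ge by simp
  then show ?thesis by (simp add: switch_gain_def)
qed

text \<open>
  With at most \<open>t\<close> switches so far, each of them gained at most \<open>B\<close> and the rest is a single
  stretch without switches. With more than \<open>t\<close> switches, the covering estimate pays for the
  surplus.
\<close>

lemma collected_le_ideal:
  assumes first: "1 - L \<le> \<tau> 1"
    and spacing: "\<And>n. 1 \<le> n \<Longrightarrow> 2 - 2 * L \<le> \<tau> (Suc n) - \<tau> n"
    and t: "0 \<le> t" "\<tau> N \<le> t"
  shows "H (t - real N) + switch_gain \<tau> N \<le> ideal t"
proof -
  have ideal: "ideal t = ideal (t - real N) + real N * B"
    using ideal_add_nat[of "t - real N" N] by simp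
  show ?thesis
  proof (cases "real N \<le> t")
    case True
    then show ?thesis
      using primitive_le_ideal[of "t - real N"] switch_gain_le[of \<tau> N] ideal by simp
  next
    case False
    then obtain M where N: "N = Suc M" using t(1) by (cases N) auto
    have "switch_gain \<tau> N \<le> real M * B + H (t - real M)"
      using switch_gain_le_early[of \<tau> M] first spacing
        mono[of "\<tau> N - real M" "t - real M"] t(2) unfolding N by fastforce
    moreover have "H (t - real N) + H (t - real M) \<le> ideal (t - real N) + B"
      using primitive_pair_le_ideal[of "t - real N"] False by (simp add: N)
    ultimately show ?thesis using ideal by (simp add: N algebra_simps)
  qed
qed

lemma ideal_le_primitive_near:
  assumes "L - 1 \<le> y" "y \<le> 1"
  shows "ideal y \<le> H y"
proof (cases "0 \<le> y")
  case True
  then show ?thesis using ideal_unit_interval assms by simp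
next
  case False
  have "ideal y = H (y + 1) - B"
    using ideal_add_nat[of y 1] ideal_unit_interval[of "y + 1"] False assms L_ge by simp
  also have "\<dots> \<le> 0"
    using mono[of "y + 1" "2 * L"] plateau[of "2 * L"] False L_ge by simp
  also have "0 = H y" using rest[of y] False assms L_ge by simp
  finally show ?thesis .
qed

text \<open>
  A switch in its range gains a full bump \<open>B\<close>, as it happens after one bump and before the
  next; and the current phase then stays in \<open>[L - 1, 1]\<close>, where \<open>H\<close> has no bump besides the
  one at \<open>[0, L]\<close>.
\<close>

lemma ideal_le_collected:
  assumes "\<And>n. 1 \<le> n \<Longrightarrow> real n - 1 + L \<le> \<tau> n \<and> \<tau> n \<le> real n"
    and "\<tau> 0 = 0" "\<tau> N \<le> t" "t \<le> \<tau> (Suc N)"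
  shows "ideal t \<le> H (t - real N) + switch_gain \<tau> N"
proof -
  have "L - 1 \<le> t - real N"
    using assms(1)[of N] assms(2,3) L_le by (cases "N = 0") auto
  moreover have "t - real N \<le> 1" using assms(1)[of "Suc N"] assms(4) by simp
  ultimately show ?thesis
    using ideal_le_primitive_near ideal_add_nat[of "t - real N" N]
      switch_gain_in_range[of N \<tau>] assms(1) by simp
qed

text \<open>
  When the period \<open>2 * L\<close> is \<open>1\<close>, a switch does not change the phase modulo the period.
\<close>

lemma ideal_eq_collected_half:
  assumes "L = 1 / 2"
  shows "ideal t = H (t - real N) + switch_gain \<tau> N"
proof -
  have H1: "H (y + 1) = H y + B" for y using shift[of y] assms by simp
  have "H (y + real n) = H y + real n * B" for y n
  proof (induction n)
    case (Suc n)
    then show ?case using H1[of "y + real n"] by (simp add: algebra_simps)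
  qed simp
  note Hn = this
  have gain: "switch_gain \<tau> N = real N * B"
    using H1[of "\<tau> (Suc n) - real (Suc n)" for n] by (simp add: switch_gain_def)
  have "ideal (t - real N) = H (t - real N)"
  proof (cases "0 \<le> t - real N")
    case True
    then show ?thesis
      using Hn[of "frac (t - real N)" "nat \<lfloor>t - real N\<rfloor>"]
      by (simp add: ideal_def) (simp add: frac_def)
  next
    case False
    then show ?thesis
      using Hn[of "t - real N" "nat (- \<lfloor>t - real N\<rfloor>)"]
      by (simp add: ideal_def frac_def)
  qed
  then show ?thesis using ideal_add_nat[of "t - real N" N] gain by simp
qed

text \<open>
  Consider the first switch outside its range. If it is late, the stretch before it runs
  into the negative half period while the ideal sequence has started the next bump. If it is
  early, at phase \<open>\<psi> < L\<close>, then \<open>\<psi> \<ge> 1 - L\<close> by the gap condition and since the preceding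
  switch is in its range, so the new phase lies in the negative half period and nothing is
  collected while the ideal sequence is still inside a bump. Either way the ideal sequence
  is strictly ahead on an open interval. Equality is therefore needed only at one time in
  every open interval, which is what an almost everywhere statement provides.
\<close>

lemma in_range_if_collected_eq_ideal:
  assumes half: "1 / 2 < L"
    and mono_\<tau>: "strict_mono \<tau>" and zero: "\<tau> 0 = 0"
    and first: "1 - L \<le> \<tau> 1"
    and spacing: "\<And>n. 1 \<le> n \<Longrightarrow> 2 - 2 * L \<le> \<tau> (Suc n) - \<tau> n"
    and eq: "\<And>a b N. 0 \<le> a \<Longrightarrow> a < b \<Longrightarrow> \<tau> N \<le> a \<Longrightarrow> b \<le> \<tau> (Suc N) \<Longrightarrow>
      \<exists>t. a < t \<and> t < b \<and> H (t - real N) + switch_gain \<tau> N = ideal t"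
  shows "1 \<le> n \<Longrightarrow> real n - 1 + L \<le> \<tau> n \<and> \<tau> n \<le> real n"
proof (induction n rule: less_induct)
  case (less n)
  then obtain N where n: "n = Suc N" by (cases n) auto
  have gain: "switch_gain \<tau> N = real N * B"
    using less.IH n by (intro switch_gain_in_range) auto
  have \<tau>N: "0 \<le> \<tau> N" "\<tau> N \<le> real N"
    using strict_mono_less_eq[OF mono_\<tau>, of 0 N] zero less.IH[of N] n
    by (cases "N = 0"; simp)+
  have lt: "\<tau> N < \<tau> (Suc N)" "\<tau> (Suc N) < \<tau> (Suc (Suc N))"
    using mono_\<tau> by (auto simp: strict_mono_def)
  have near: "ideal (u + real N) = H u + real N * B" if "0 \<le> u" "u \<le> 1" for u
    using that ideal_add_nat ideal_unit_interval by simp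
  have "\<tau> (Suc N) \<le> real (Suc N)"
  proof (rule ccontr)
    assume "\<not> ?thesis"
    \<comment> \<open>the phase \<open>t - N\<close> lies in \<open>(1, 2 * L)\<close>, beyond the bump, which ends at \<open>L \<le> 1\<close>\<close>
    then obtain t where t: "real N + 1 < t" "t < min (\<tau> (Suc N)) (real N + 2 * L)"
        and teq: "H (t - real N) + switch_gain \<tau> N = ideal t"
      using eq[of "real N + 1" "min (\<tau> (Suc N)) (real N + 2 * L)" N] \<tau>N half by auto
    have "H (t - real N) = B" using plateau[of "t - real N"] t L_le by simp
    moreover have "ideal t = H (t - real N - 1) + real N * B + B"
      using near[of "t - real N - 1"] ideal_add_nat[of "t - 1" 1] t L_le by simp
    moreover have "0 < H (t - real N - 1)"
      using strict[of 0 "t - real N - 1"] rest[of 0] t L_le half by simp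
    ultimately show False using teq gain by simp
  qed
  moreover have "real N + L \<le> \<tau> (Suc N)"
  proof (rule ccontr)
    assume early: "\<not> ?thesis"
    define \<psi> where "\<psi> = \<tau> (Suc N) - real N"
    obtain t where t: "\<tau> (Suc N) < t" "t < min (real N + L) (\<tau> (Suc (Suc N)))"
        and teq: "H (t - real (Suc N)) + switch_gain \<tau> (Suc N) = ideal t"
      using eq[of "\<tau> (Suc N)" "min (real N + L) (\<tau> (Suc (Suc N)))" "Suc N"] \<tau>N lt early
      by auto
    have \<psi>: "1 - L \<le> \<psi>"
      using first spacing[of N] less.IH[of N] n by (cases "N = 0") (auto simp: \<psi>_def)
    have "switch_gain \<tau> (Suc N) = real N * B + H \<psi>"
      using gain rest[of "\<psi> - 1"] \<psi> early L_le
      by (simp add: switch_gain_def \<psi>_def algebra_simps)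
    moreover have "H (t - real (Suc N)) = 0"
      using rest[of "t - real (Suc N)"] t \<psi> L_le by (simp add: \<psi>_def)
    moreover have "ideal t = H (t - real N) + real N * B"
      using near[of "t - real N"] t \<psi> L_le by (simp add: \<psi>_def)
    moreover have "H \<psi> < H (t - real N)"
      using strict[of \<psi> "t - real N"] t \<psi> L_le by (simp add: \<psi>_def)
    ultimately show False using teq by simp
  qed
  ultimately show ?case by (simp add: n)
qed

end

section \<open>Bumps and their primitive\<close>

definition bump :: "real \<Rightarrow> real \<Rightarrow> real" where
  "bump p y = (max 0 (sin (p / 2 * pi * y)))\<^sup>2"

lemma bump_nonneg: "0 \<le> bump p y"
  by (simp add: bump_def)

lemma continuous_on_bump: "continuous_on A (bump p)"
  unfolding bump_def by (intro continuous_intros)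

lemma bump_periodic:
  assumes "0 < p"
  shows "bump p (y + 4 / p) = bump p y"
proof -
  have "p / 2 * pi * (y + 4 / p) = p / 2 * pi * y + 2 * pi"
    using assms by (simp add: field_simps)
  then show ?thesis by (simp only: bump_def sin_periodic)
qed

lemma bump_pos:
  assumes "0 < p" "0 < y" "y < 2 / p"
  shows "0 < bump p y"
proof -
  have "p / 2 * pi * y < pi"
    using assms by (simp add: field_simps)
  then have "0 < sin (p / 2 * pi * y)"
    using assms by (intro sin_gt_zero) auto
  then show ?thesis by (simp add: bump_def max_def)
qed

lemma bump_rest:
  assumes "0 < p" "- (2 / p) \<le> y" "y \<le> 0"
  shows "bump p y = 0"
proof -
  have "p / 2 * (- y) \<le> 1" using assms by (simp add: field_simps)
  then have "p / 2 * (- y) * pi \<le> 1 * pi" by (intro mult_right_mono) auto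
  moreover have "0 \<le> p / 2 * pi * (- y)" using assms by (intro mult_nonneg_nonneg) auto
  ultimately have "0 \<le> sin (p / 2 * pi * (- y))"
    by (intro sin_ge_zero) (auto simp: mult_ac)
  then show ?thesis by (simp add: bump_def)
qed

text \<open>
  The bump has an antiderivative on the whole line, which satisfies the axioms by
  periodicity and by the sign of the sine on the two half periods.
\<close>

lemma bump_primitive_exists:
  assumes "2 \<le> p" "p \<le> 4"
  obtains H B where "bump_primitive (2 / p) B H" "\<And>y. DERIV H y :> bump p y"
proof -
  have "\<exists>F. \<forall>x. - \<infinity> < ereal x \<longrightarrow> ereal x < \<infinity> \<longrightarrow> (F has_vector_derivative bump p x) (at x)"
    using continuous_on_bump[of UNIV p]
    by (intro einterval_antiderivative) (auto simp: continuous_on_eq_continuous_at)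
  then obtain F where F: "\<And>y. DERIV F y :> bump p y"
    by (auto simp: has_real_derivative_iff_has_vector_derivative)
  define H where "H y = F y - F 0" for y
  have dH: "DERIV H y :> bump p y" for y
    unfolding H_def by (auto intro!: derivative_eq_intros F)
  have mono: "H x \<le> H y" if "x \<le> y" for x y
  proof (rule DERIV_nonneg_imp_nondecreasing[OF that])
    show "\<exists>d. DERIV H z :> d \<and> 0 \<le> d" for z
      using dH[of z] bump_nonneg[of p z] by blast
  qed
  have "bump_primitive (2 / p) (H (4 / p)) H"
  proof
    show "1 / 2 \<le> 2 / p" "2 / p \<le> 1" using assms by (auto simp: field_simps)
    show "H x \<le> H y" if "x \<le> y" for x y by (rule mono[OF that])
    show "H (y + 2 * (2 / p)) = H y + H (4 / p)" for y
    proof -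
      have "DERIV (\<lambda>y. H (y + 4 / p)) x :> bump p (x + 4 / p) * 1" for x
        by (rule DERIV_chain2[OF dH]) (auto intro!: derivative_eq_intros)
      then have "DERIV (\<lambda>y. H (y + 4 / p) - H y) x :> bump p (x + 4 / p) * 1 - bump p x" for x
        by (intro DERIV_diff dH)
      then have "DERIV (\<lambda>y. H (y + 4 / p) - H y) x :> 0" for x
        using bump_periodic[of p] assms by simp
      then have "H (y + 4 / p) - H y = H (0 + 4 / p) - H 0"
        using DERIV_isconst_all[of "\<lambda>y. H (y + 4 / p) - H y"] by blast
      then show ?thesis by (simp add: H_def)
    qed
    show "H y = 0" if y: "- (2 / p) \<le> y" "y \<le> 0" for y
    proof (cases "y = 0")
      case False
      then obtain z where "y < z" "z < 0" "H 0 - H y = (0 - y) * bump p z"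
        using MVT2[of y 0 H "bump p"] y dH by auto
      then show ?thesis using bump_rest[of p z] y assms by (simp add: H_def)
    qed (simp add: H_def)
    show "H x < H y" if "0 \<le> x" "x < y" "y \<le> 2 / p" for x y
    proof -
      obtain z where "x < z" "z < y" "H y - H x = (y - x) * bump p z"
        using MVT2[OF \<open>x < y\<close> dH] by blast
      then show ?thesis using bump_pos[of p z] that assms
        by (smt (verit) mult_pos_pos)
    qed
  qed
  then show ?thesis using that dH by blast
qed

section \<open>The truncated kernel and its cumulative mass\<close>

lemma K_fun_on_interval:
  assumes "strict_mono \<tau>" "\<tau> n < x" "x < \<tau> (Suc n)"
  shows "K_fun p \<tau> x = sin (p / 2 * pi * (x - real n)) / (pi * x)"
proof -
  have "x \<notin> {\<tau> m<..<\<tau> (m + 1)}" if "m \<noteq> n" for m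
  proof
    assume "x \<in> {\<tau> m<..<\<tau> (m + 1)}"
    then have "\<tau> m < \<tau> (Suc n)" "\<tau> n < \<tau> (Suc m)" using assms by auto
    then show False using that strict_mono_less[OF assms(1)] by simp
  qed
  then have "K_fun p \<tau> x = (\<Sum>m\<in>{n}. indicator {\<tau> m<..<\<tau> (m + 1)} x *
      (sin (p / 2 * pi * (x - real m)) / (pi * x)))"
    unfolding K_fun_def by (intro suminf_finite) auto
  then show ?thesis using assms by simp
qed

text \<open>
  The square of the truncated kernel without its factor \<open>1 / (pi * x)\<close>. On each interval of
  the sequence it is a translated bump, so its integrals are differences of the primitive.
\<close>

definition signal :: "real \<Rightarrow> (nat \<Rightarrow> real) \<Rightarrow> real \<Rightarrow> real" where
  "signal p \<tau> x = (max 0 (K_fun p \<tau> x * (pi * x)))\<^sup>2"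

lemma signal_nonneg: "0 \<le> signal p \<tau> x"
  by (simp add: signal_def)

lemma borel_measurable_K_fun [measurable]: "K_fun p \<tau> \<in> borel_measurable borel"
  unfolding K_fun_def by measurable

lemma borel_measurable_signal [measurable]: "signal p \<tau> \<in> borel_measurable borel"
  unfolding signal_def by measurable

lemma signal_on_interval:
  assumes "strict_mono \<tau>" "0 < x" "\<tau> n < x" "x < \<tau> (Suc n)"
  shows "signal p \<tau> x = bump p (x - real n)"
  using assms by (simp add: signal_def bump_def K_fun_on_interval)

lemma E_val_eq_signal:
  "E_val p \<tau> = (\<integral>\<^sup>+x\<in>{0..}. ennreal (signal p \<tau> x / (pi * x)\<^sup>2) \<partial>lborel)"
  unfolding E_val_def
proof (intro nn_integral_cong_AE eventually_mono[OF AE_lborel_singleton[of 0]])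
  fix x :: real
  assume "x \<noteq> 0"
  moreover have "max 0 (K_fun p \<tau> x * (pi * x)) = max 0 (K_fun p \<tau> x) * (pi * x)" if "0 < x"
    using max_mult_distrib_right[of 0 "K_fun p \<tau> x" "pi * x"] that by simp
  ultimately show "ennreal ((max 0 (K_fun p \<tau> x))\<^sup>2) * indicator {0..} x =
      ennreal (signal p \<tau> x / (pi * x)\<^sup>2) * indicator {0..} x"
    by (auto split: split_indicator simp: signal_def power_mult_distrib)
qed

lemma nn_integral_interval_split:
  fixes f :: "real \<Rightarrow> ennreal"
  assumes [measurable]: "f \<in> borel_measurable borel" and "a \<le> b" "b \<le> c"
  shows "(\<integral>\<^sup>+x\<in>{a..c}. f x \<partial>lborel) = (\<integral>\<^sup>+x\<in>{a..b}. f x \<partial>lborel) + (\<integral>\<^sup>+x\<in>{b..c}. f x \<partial>lborel)"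
proof -
  have "(\<integral>\<^sup>+x\<in>{a..c}. f x \<partial>lborel) =
      (\<integral>\<^sup>+x. f x * indicator {a..b} x + f x * indicator {b..c} x \<partial>lborel)"
    using assms(2,3)
    by (intro nn_integral_cong_AE eventually_mono[OF AE_lborel_singleton[of b]])
      (auto split: split_indicator)
  then show ?thesis by (simp add: nn_integral_add)
qed

lemma signal_piece:
  assumes dH: "\<And>y. DERIV H y :> bump p y"
    and mono_\<tau>: "strict_mono \<tau>" and zero_\<tau>: "\<tau> 0 = 0"
    and "\<tau> n \<le> a" "a \<le> b" "b \<le> \<tau> (Suc n)"
  shows "(\<integral>\<^sup>+x\<in>{a..b}. ennreal (signal p \<tau> x) \<partial>lborel) = ennreal (H (b - real n) - H (a - real n))"
proof -
  have "0 \<le> \<tau> n" using strict_mono_less_eq[OF mono_\<tau>, of 0 n] zero_\<tau> by simp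
  have "(\<integral>\<^sup>+x\<in>{a..b}. ennreal (signal p \<tau> x) \<partial>lborel) =
      (\<integral>\<^sup>+x\<in>{a..b}. ennreal (bump p (x - real n)) \<partial>lborel)"
    using AE_lborel_singleton[of a] AE_lborel_singleton[of b]
  proof (intro nn_integral_cong_AE, eventually_elim)
    case (elim x)
    then show ?case
      using assms \<open>0 \<le> \<tau> n\<close> signal_on_interval[OF mono_\<tau>, of x n p]
      by (auto split: split_indicator)
  qed
  also have "\<dots> = ennreal (H (b - real n) - H (a - real n))"
  proof (rule nn_integral_FTC_Icc)
    show "(\<lambda>x. bump p (x - real n)) \<in> borel_measurable borel"
      unfolding bump_def by measurable
    have "((\<lambda>x. H (x - real n)) has_real_derivative bump p (x - real n) * 1) (at x)" for x
      by (rule DERIV_chain2[OF dH]) (auto intro!: derivative_eq_intros)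
    then show "((\<lambda>x. H (x - real n)) has_real_derivative bump p (x - real n)) (at x)" for x
      by simp
  qed (use assms bump_nonneg in auto)
  finally show ?thesis .
qed

context bump_primitive
begin

lemma cumulative_signal:
  assumes dH: "\<And>y. DERIV H y :> bump p y"
    and mono_\<tau>: "strict_mono \<tau>" and zero_\<tau>: "\<tau> 0 = 0"
    and t: "\<tau> N \<le> t" "t \<le> \<tau> (Suc N)"
  shows "(\<integral>\<^sup>+x\<in>{0..t}. ennreal (signal p \<tau> x) \<partial>lborel) =
    ennreal (H (t - real N) + switch_gain \<tau> N)"
  using t
proof (induction N arbitrary: t)
  case 0
  then show ?case
    using signal_piece[OF dH mono_\<tau> zero_\<tau>, of 0 0 t] zero_\<tau> rest[of 0] L_ge
    by (simp add: switch_gain_def)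
next
  case (Suc N)
  let ?s = "\<tau> (Suc N)"
  have le: "0 \<le> \<tau> N" "\<tau> N \<le> ?s" "0 \<le> ?s"
    using strict_mono_less_eq[OF mono_\<tau>, of 0] strict_mono_less_eq[OF mono_\<tau>, of N "Suc N"] zero_\<tau>
    by auto
  have pos: "0 \<le> H (?s - real N) + switch_gain \<tau> N"
    using collected_nonneg mono_\<tau> zero_\<tau> le by blast
  have "(\<integral>\<^sup>+x\<in>{0..t}. ennreal (signal p \<tau> x) \<partial>lborel) =
      ennreal (H (?s - real N) + switch_gain \<tau> N) + ennreal (H (t - real (Suc N)) - H (?s - real (Suc N)))"
    using nn_integral_interval_split[of "\<lambda>x. ennreal (signal p \<tau> x)" 0 ?s t]
      Suc.IH[of ?s] signal_piece[OF dH mono_\<tau> zero_\<tau>, of "Suc N" ?s t] Suc.prems le by simp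
  also have "\<dots> = ennreal (H (t - real (Suc N)) + switch_gain \<tau> (Suc N))"
    using pos mono[of "?s - real (Suc N)" "t - real (Suc N)"] Suc.prems
    by (simp add: switch_gain_def ennreal_plus[symmetric] del: ennreal_plus)
  finally show ?case .
qed

end

text \<open>
  Since the gaps are at least \<open>\<delta>\<close>, the sequence is unbounded and its intervals exhaust the
  half-line.
\<close>

lemma interval_index_exists:
  fixes \<tau> :: "nat \<Rightarrow> real"
  assumes "\<tau> 0 \<le> t" "0 < \<delta>" "\<And>n. 1 \<le> n \<Longrightarrow> \<delta> \<le> \<tau> (Suc n) - \<tau> n"
  obtains N where "\<tau> N \<le> t" "t < \<tau> (Suc N)"
proof -
  have grow: "\<tau> 1 + real n * \<delta> \<le> \<tau> (Suc n)" for n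
  proof (induction n)
    case (Suc n)
    then show ?case using assms(3)[of "Suc n"] by (simp add: algebra_simps)
  qed simp
  obtain n where "t - \<tau> 1 < real n * \<delta>" using reals_Archimedean3[OF assms(2)] by blast
  then have ex: "t < \<tau> (Suc n)" using grow[of n] by simp
  define N where "N = (LEAST n. t < \<tau> (Suc n))"
  have "t < \<tau> (Suc N)" unfolding N_def using ex by (rule LeastI)
  moreover have "\<tau> N \<le> t"
  proof (cases N)
    case (Suc M)
    then show ?thesis using not_less_Least[of M "\<lambda>n. t < \<tau> (Suc n)"] by (simp add: N_def not_less)
  qed (use assms(1) in simp)
  ultimately show ?thesis using that by blast
qed

section \<open>The value of the ideal sequence\<close>

text \<open>
  On \<open>(n, n + 1)\<close> the sine of index \<open>n\<close> is nonnegative up to \<open>n + 2 / p\<close> and negative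
  afterwards, because \<open>1 \<le> 4 / p\<close> keeps the interval within one period. So truncation leaves
  exactly the bump.
\<close>

lemma E_val_of_nat:
  assumes "2 \<le> p" "p \<le> 4"
  shows "E_val p real = (\<Sum>n. \<integral>\<^sup>+x\<in>{real n..real n + 2 / p}.
        ennreal ((sin (p / 2 * pi * (x - real n)))\<^sup>2 / (pi\<^sup>2 * x\<^sup>2)) \<partial>lborel)"
proof -
  let ?f = "\<lambda>n x. ennreal ((sin (p / 2 * pi * (x - real n)))\<^sup>2 / (pi\<^sup>2 * x\<^sup>2)) *
    indicator {real n..real n + 2 / p} x"
  have "E_val p real = (\<integral>\<^sup>+x. (\<Sum>n. ?f n x) \<partial>lborel)"
    unfolding E_val_def
  proof (intro nn_integral_cong_AE eventually_mono[OF AE_not_in[OF countable_imp_null_set_lborel[of \<int>]]])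
    fix x :: real
    assume x: "x \<notin> \<int>"
    show "ennreal ((max 0 (K_fun p real x))\<^sup>2) * indicator {0..} x = (\<Sum>n. ?f n x)"
    proof (cases "0 \<le> x")
      case False
      then show ?thesis by simp
    next
      case True
      define n where "n = nat \<lfloor>x\<rfloor>"
      have "real n \<noteq> x" using x by auto
      moreover have "real n \<le> x" "x < real n + 1" using True by (auto simp: n_def)
      ultimately have n: "real n < x" "x < real n + 1" by auto
      have p: "2 / p \<le> 1" "1 \<le> 4 / p" using assms by (auto simp: field_simps)
      have "?f m x = 0" if "m \<noteq> n" for m
        using that n p by (auto simp: indicator_def)
      then have "(\<Sum>m. ?f m x) = (\<Sum>m\<in>{n}. ?f m x)"
        using suminf_finite[of "{n}" "\<lambda>m. ?f m x"] by blast
      also have "(\<Sum>m\<in>{n}. ?f m x) = ennreal ((max 0 (K_fun p real x))\<^sup>2)"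
      proof -
        let ?s = "sin (p / 2 * pi * (x - real n))"
        have K: "K_fun p real x = ?s / (pi * x)"
          using n by (intro K_fun_on_interval) (auto simp: strict_mono_def)
        show ?thesis
        proof (cases "x \<le> real n + 2 / p")
          case True
          then have "p / 2 * (x - real n) \<le> 1" using assms by (simp add: field_simps)
          then have "p / 2 * (x - real n) * pi \<le> 1 * pi" by (intro mult_right_mono) auto
          then have "0 \<le> ?s"
            using n assms by (intro sin_ge_zero) (auto simp: mult_ac)
          then show ?thesis
            using K True n by (simp add: power_divide power_mult_distrib)
        next
          case False
          have "x - real n < 4 / p" using n p by simp
          then have "p / 2 * (x - real n) < 2" using assms by (simp add: field_simps)
          then have "p / 2 * (x - real n) * pi < 2 * pi" by (rule mult_strict_right_mono) simp
          moreover have "1 < p / 2 * (x - real n)" using False assms by (simp add: field_simps)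
          then have "1 * pi < p / 2 * (x - real n) * pi" by (rule mult_strict_right_mono) simp
          ultimately have "?s < 0" by (intro sin_lt_zero) (auto simp: mult_ac)
          then have "K_fun p real x \<le> 0" using K n by (simp add: divide_nonpos_pos)
          then show ?thesis using False by simp
        qed
      qed
      finally show ?thesis using True by simp
    qed
  qed (auto simp: Ints_def)
  also have "\<dots> = (\<Sum>n. \<integral>\<^sup>+x. ?f n x \<partial>lborel)"
    by (rule nn_integral_suminf) measurable
  finally show ?thesis .
qed

text \<open>
  The truncated kernel is at most \<open>p / 2\<close> on \<open>(0, 1)\<close>, by \<open>sin y \<le> y\<close>, and at most \<open>1 / x\<close>
  beyond.
\<close>

lemma E_val_of_nat_finite:
  assumes "0 < p"
  shows "E_val p real < \<infinity>"
proof -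
  have "E_val p real \<le> (\<integral>\<^sup>+x. ennreal ((p / 2)\<^sup>2) * indicator {0..1} x +
      ennreal (1 / x\<^sup>2) * indicator {1..} x \<partial>lborel)"
    unfolding E_val_def
  proof (intro nn_integral_mono_AE eventually_mono[OF AE_not_in[OF countable_imp_null_set_lborel[of \<int>]]])
    fix x :: real
    assume x: "x \<notin> \<int>"
    show "ennreal ((max 0 (K_fun p real x))\<^sup>2) * indicator {0..} x \<le>
      ennreal ((p / 2)\<^sup>2) * indicator {0..1} x + ennreal (1 / x\<^sup>2) * indicator {1..} x"
    proof (cases "0 \<le> x")
      case True
      define n where "n = nat \<lfloor>x\<rfloor>"
      have "real n \<noteq> x" using x by auto
      moreover have "real n \<le> x" "x < real n + 1" using True by (auto simp: n_def)
      ultimately have n: "real n < x" "x < real n + 1" by auto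
      let ?s = "sin (p / 2 * pi * (x - real n))"
      have K: "K_fun p real x = ?s / (pi * x)"
        using n by (intro K_fun_on_interval) (auto simp: strict_mono_def)
      have "x > 0" using n by simp
      show ?thesis
      proof (cases "x < 1")
        case True
        then have "n = 0" using n by simp
        then have "?s \<le> p / 2 * pi * x"
          using sin_x_le_x[of "p / 2 * pi * x"] assms \<open>0 < x\<close> by simp
        then have "K_fun p real x \<le> p / 2"
          unfolding K using \<open>0 < x\<close> by (subst pos_divide_le_eq) (auto simp: mult_ac)
        then have "max 0 (K_fun p real x) \<le> p / 2" using assms by simp
        then have "(max 0 (K_fun p real x))\<^sup>2 \<le> (p / 2)\<^sup>2" by (intro power_mono) auto
        then show ?thesis using True \<open>0 < x\<close> by (auto intro!: ennreal_leI)
      next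
        case False
        have "?s \<le> 1 * pi" using sin_le_one[of "p / 2 * pi * (x - real n)"] pi_ge_two by linarith
        then have "K_fun p real x \<le> 1 / x"
          unfolding K using \<open>0 < x\<close> by (subst pos_divide_le_eq) auto
        then have "max 0 (K_fun p real x) \<le> 1 / x" using \<open>0 < x\<close> by simp
        then have "(max 0 (K_fun p real x))\<^sup>2 \<le> (1 / x)\<^sup>2" by (intro power_mono) auto
        moreover have "x \<noteq> 1" using x by auto
        ultimately show ?thesis using False \<open>0 < x\<close>
          by (auto intro!: ennreal_leI simp: power_divide)
      qed
    qed simp
  qed (auto simp: Ints_def)
  also have "\<dots> = ennreal ((p / 2)\<^sup>2) * emeasure lborel {0..1::real} +
      (\<integral>\<^sup>+x. ennreal (1 / x\<^sup>2) * indicator {1..} x \<partial>lborel)"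
    by (subst nn_integral_add) (auto simp: nn_integral_cmult_indicator)
  also have "\<dots> < \<infinity>"
  proof -
    define F where "F x = - (1 / x)" for x :: real
    have "(\<integral>\<^sup>+x. ennreal (1 / x\<^sup>2) * indicator {1..} x \<partial>lborel) = ennreal (0 - F 1)"
    proof (rule nn_integral_FTC_atLeast)
      show "(F has_real_derivative 1 / x\<^sup>2) (at x)" if "1 \<le> x" for x
        unfolding F_def using that
        by (auto intro!: derivative_eq_intros simp: power2_eq_square)
      show "(F \<longlongrightarrow> 0) at_top" unfolding F_def by real_asymp
    qed auto
    then show ?thesis by (simp add: ennreal_mult_less_top)
  qed
  finally show ?thesis .
qed

section \<open>The extremal problem\<close>

theorem theorem3p1:
  fixes p \<delta>1 \<delta>2 :: real
  assumes "2 \<le> p" and "p \<le> 4"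
    and "0 < \<delta>1" and "0 < \<delta>2"
    and "1 - 2 / p \<le> \<delta>1" and "\<delta>1 \<le> 1"
    and "2 - 4 / p \<le> \<delta>2" and "\<delta>2 \<le> 1"
  shows "E_sup p \<delta>1 \<delta>2 < \<infinity> \<and>
    E_sup p \<delta>1 \<delta>2 =
      (\<Sum>n. \<integral>\<^sup>+x\<in>{real n..real n + 2 / p}.
        ennreal ((sin (p / 2 * pi * (x - real n)))\<^sup>2 / (pi\<^sup>2 * x\<^sup>2)) \<partial>lborel) \<and>
    (p < 4 \<longrightarrow> (\<forall>\<tau>\<in>T_seq \<delta>1 \<delta>2.
      E_val p \<tau> = E_sup p \<delta>1 \<delta>2 \<longleftrightarrow>
        (\<forall>n\<ge>1. \<tau> n \<in> {real n - 1 + 2 / p..real n}))) \<and>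
    (p = 4 \<longrightarrow> (\<forall>\<tau>\<in>T_seq \<delta>1 \<delta>2. E_val p \<tau> = E_sup p \<delta>1 \<delta>2))"
proof -
  obtain H B where prim: "bump_primitive (2 / p) B H" and dH: "\<And>y. DERIV H y :> bump p y"
    using bump_primitive_exists assms(1,2) by blast
  interpret bump_primitive "2 / p" B H by (rule prim)
  let ?A = "\<lambda>\<tau> t. \<integral>\<^sup>+x\<in>{0..t}. ennreal (signal p \<tau> x) \<partial>lborel"
  have real_in: "real \<in> T_seq \<delta>1 \<delta>2"
    using assms by (auto simp: T_seq_def strict_mono_def)
  have T: "strict_mono \<tau>" "\<tau> 0 = 0" "1 - 2 / p \<le> \<tau> 1"
      "\<And>n. 1 \<le> n \<Longrightarrow> 2 - 2 * (2 / p) \<le> \<tau> (Suc n) - \<tau> n"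
      "\<And>n. 1 \<le> n \<Longrightarrow> \<delta>2 \<le> \<tau> (Suc n) - \<tau> n"
    if "\<tau> \<in> T_seq \<delta>1 \<delta>2" for \<tau>
    using that assms by (fastforce simp: T_seq_def)+
  have A_eq: "?A \<tau> t = ennreal (H (t - real N) + switch_gain \<tau> N)"
    if "\<tau> \<in> T_seq \<delta>1 \<delta>2" "\<tau> N \<le> t" "t \<le> \<tau> (Suc N)" for \<tau> N t
    using cumulative_signal[OF dH T(1,2)[OF that(1)] that(2,3)] .
  have index: "\<exists>N. \<tau> N \<le> t \<and> t \<le> \<tau> (Suc N)" if "\<tau> \<in> T_seq \<delta>1 \<delta>2" "0 \<le> t" for \<tau> t
    using interval_index_exists[of \<tau> t \<delta>2] T(2,5)[OF that(1)] that(2) assms(4) by (metis less_imp_le)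
  have A_le: "?A \<tau> t \<le> ennreal (ideal t)" if "\<tau> \<in> T_seq \<delta>1 \<delta>2" "0 \<le> t" for \<tau> t
  proof -
    obtain N where "\<tau> N \<le> t" "t \<le> \<tau> (Suc N)" using index \<open>0 \<le> t\<close> \<open>\<tau> \<in> _\<close> by blast
    then show ?thesis
      using A_eq[OF \<open>\<tau> \<in> _\<close>] collected_le_ideal[OF T(3,4)[OF \<open>\<tau> \<in> _\<close>] \<open>0 \<le> t\<close>]
      by (simp add: ennreal_leI)
  qed
  have A_ge: "ennreal (ideal t) \<le> ?A \<tau> t"
    if \<tau>: "\<tau> \<in> T_seq \<delta>1 \<delta>2" and "0 \<le> t"
      and range: "\<And>n. 1 \<le> n \<Longrightarrow> real n - 1 + 2 / p \<le> \<tau> n \<and> \<tau> n \<le> real n" for \<tau> t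
  proof -
    obtain N where "\<tau> N \<le> t" "t \<le> \<tau> (Suc N)" using index \<open>0 \<le> t\<close> \<tau> by blast
    then show ?thesis
      using A_eq[OF \<tau>] ideal_le_collected[of \<tau> N t] range T(2)[OF \<tau>] by (simp add: ennreal_leI)
  qed
  \<comment> \<open>the ideal sequence satisfies the range condition, so both estimates apply to it\<close>
  have A_real: "?A real t = ennreal (ideal t)" if "0 \<le> t" for t
    using A_le[OF real_in that] A_ge[OF real_in that] L_le by (simp add: order_antisym)
  note meas = borel_measurable_signal signal_nonneg
  have E_le: "E_val p \<tau> \<le> E_val p real" if "\<tau> \<in> T_seq \<delta>1 \<delta>2" for \<tau>
    unfolding E_val_eq_signal using A_le[OF that] A_real
    by (intro inverse_square_integral_mono meas) simp
  have E_sup: "E_sup p \<delta>1 \<delta>2 = E_val p real"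
    unfolding E_sup_def using E_le real_in by (intro antisym SUP_least SUP_upper) auto
  have E_eqI: "E_val p \<tau> = E_val p real"
    if "\<tau> \<in> T_seq \<delta>1 \<delta>2" "\<And>t. 0 \<le> t \<Longrightarrow> ennreal (ideal t) \<le> ?A \<tau> t" for \<tau>
  proof (rule antisym[OF E_le[OF that(1)]])
    show "E_val p real \<le> E_val p \<tau>"
      unfolding E_val_eq_signal using that(2) A_real
      by (intro inverse_square_integral_mono meas) simp
  qed
  have finite: "E_val p real < \<infinity>" using E_val_of_nat_finite assms(1) by simp
  have range_if_eq: "real n - 1 + 2 / p \<le> \<tau> n \<and> \<tau> n \<le> real n"
    if \<tau>: "\<tau> \<in> T_seq \<delta>1 \<delta>2" and eq: "E_val p \<tau> = E_val p real" and "p < 4" "1 \<le> n" for \<tau> n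
  proof (rule in_range_if_collected_eq_ideal[OF _ T(1-4)[OF \<tau>] _ \<open>1 \<le> n\<close>])
    show "1 / 2 < 2 / p" using assms(1) \<open>p < 4\<close> by (simp add: field_simps)
    fix a b N
    assume ab: "0 \<le> a" "a < b" "\<tau> N \<le> a" "b \<le> \<tau> (Suc N)"
    have "AE t in lborel. 0 < t \<longrightarrow> ?A \<tau> t = ?A real t"
      using eq finite A_le[OF \<tau>] A_real
      unfolding E_val_eq_signal
      by (intro inverse_square_integral_eq_imp_AE meas) auto
    from AE_lborel_imp_ex_between[OF this \<open>a < b\<close>]
    obtain t where t: "a < t" "t < b" "?A \<tau> t = ?A real t" using ab(1) by auto
    then have "ennreal (H (t - real N) + switch_gain \<tau> N) = ennreal (ideal t)"
      using A_eq[OF \<tau>, of N t] A_real[of t] ab by simp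
    \<comment> \<open>\<open>ennreal\<close> identifies all nonpositive reals, so both sides must be shown nonnegative\<close>
    moreover have "0 \<le> H (t - real N) + switch_gain \<tau> N"
      using collected_nonneg T(1,2)[OF \<tau>] t(1) ab(3) by simp
    moreover have "H (t - real N) + switch_gain \<tau> N \<le> ideal t"
      using collected_le_ideal[OF T(3,4)[OF \<tau>]] t(1) ab by simp
    ultimately show "\<exists>t. a < t \<and> t < b \<and> H (t - real N) + switch_gain \<tau> N = ideal t"
      using t by auto
  qed
  have "E_val p \<tau> = E_val p real \<longleftrightarrow> (\<forall>n\<ge>1. \<tau> n \<in> {real n - 1 + 2 / p..real n})"
    if \<tau>: "\<tau> \<in> T_seq \<delta>1 \<delta>2" and "p < 4" for \<tau>
  proof
    assume "E_val p \<tau> = E_val p real"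
    then show "\<forall>n\<ge>1. \<tau> n \<in> {real n - 1 + 2 / p..real n}"
      using range_if_eq[OF \<tau> _ \<open>p < 4\<close>] by simp
  next
    assume "\<forall>n\<ge>1. \<tau> n \<in> {real n - 1 + 2 / p..real n}"
    then have range: "real n - 1 + 2 / p \<le> \<tau> n \<and> \<tau> n \<le> real n" if "1 \<le> n" for n
      using that by simp
    show "E_val p \<tau> = E_val p real"
      by (rule E_eqI[OF \<tau>]) (rule A_ge[OF \<tau> _ range])
  qed
  moreover have "E_val p \<tau> = E_val p real" if \<tau>: "\<tau> \<in> T_seq \<delta>1 \<delta>2" and "p = 4" for \<tau>
  proof (rule E_eqI[OF \<tau>])
    fix t :: real
    assume "0 \<le> t"
    obtain N where "\<tau> N \<le> t" "t \<le> \<tau> (Suc N)" using index \<open>0 \<le> t\<close> \<tau> by blast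
    then show "ennreal (ideal t) \<le> ?A \<tau> t"
      using A_eq[OF \<tau>] ideal_eq_collected_half[of t N \<tau>] \<open>p = 4\<close> by simp
  qed
  ultimately show ?thesis
    unfolding E_sup E_val_of_nat[OF assms(1,2), symmetric] using finite by blast
qed

end
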